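(* Let $\mathbb{T}=(T_{ij})$ be a $d \times d$ operator matrix where $T_{ij}\in \mathcal{B}_{A^{1/2}}(\mathcal{H})$ for all $i,j\in\{1,\dots,d\}$. Then $$\omega_\mathbb{A}(\mathbb{T})\geq \max \left \{ \omega_A(T_{ii}),\ \omega_{\mathbb{A}}(\mathbb{S}_{i}): 1\leq i\leq d\right \},$$ where for each $i\in\{1,\dots,d\}$ the operator matrix $\mathbb{S}_i=(s^{i}_{jk})_{d \times d}$ is defined by $s^{i}_{jk}=O$ if $j=i$ or $k=i$, and $s^{i}_{jk}=T_{jk}$ otherwise (that is, $\mathbb{S}_i$ is obtained from $\mathbb{T}$ by replacing the $i$-th row and the $i$-th column by zeros).
   Context: $\mathcal{H}$ is a complex Hilbert space with inner product $\langle\cdot\mid\cdot\rangle$ (linear in the first variable), and $A\in\mathcal{B}(\mathcal{H})$ is a nonzero positive (semi-definite) operator. For any positive operator $A$ on a Hilbert space, put $\langle x\mid y\rangle_A=\langle Ax\mid y\rangle$ and $\|x\|_A=\langle x\mid x\rangle_A^{1/2}$. $\mathcal{B}_{A^{1/2}}(\mathcal{H})$ is the set of $T\in\mathcal{B}(\mathcal{H})$ for which there is $\lambda>0$ with $\|Tx\|_A\le\lambda\|x\|_A$ for all $x\in\mathcal{H}$; for such $T$, $\omega_A(T)=\sup\{|\langle Tx\mid x\rangle_A| : \|x\|_A=1\}$. $\mathbb{H}=\oplus_{i=1}^d\mathcal{H}$ is the Hilbert space direct sum with $\langle x,y\rangle=\sum_{k=1}^d\langle x_k\mid y_k\rangle$,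 $\mathbb{A}=\mathrm{diag}(A,\dots,A)$ is the $d\times d$ diagonal operator matrix, a positive operator on $\mathbb{H}$, and $\omega_{\mathbb{A}}$ is defined in the same way as $\omega_A$ with $(\mathbb{H},\mathbb{A})$ in place of $(\mathcal{H},A)$. *)

theory Defs
  imports "HOL-Analysis.Analysis"
begin

class complex_vector = real_vector +
  fixes scaleC :: "complex \<Rightarrow> 'a \<Rightarrow> 'a"  (infixr "*\<^sub>C" 75)
  assumes scaleC_add_right: "c *\<^sub>C (x + y) = c *\<^sub>C x + c *\<^sub>C y"
    and scaleC_add_left: "(b + c) *\<^sub>C x = b *\<^sub>C x + c *\<^sub>C x"
    and scaleC_scaleC: "b *\<^sub>C c *\<^sub>C x = (b * c) *\<^sub>C x"
    and scaleC_one: "1 *\<^sub>C x = x"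
    and scaleR_scaleC: "r *\<^sub>R x = complex_of_real r *\<^sub>C x"

text \<open>
  The complex inner product is linear in its first argument. A complex inner product space is
  also made a \<^class>\<open>real_inner\<close> space, with real part as the real inner product; positive
  definiteness of \<open>cinner\<close> and \<open>norm x = sqrt (cinner x x)\<close> are inherited from there.
\<close>

class complex_inner = complex_vector + real_inner +
  fixes cinner :: "'a \<Rightarrow> 'a \<Rightarrow> complex"
  assumes cinner_commute: "cinner x y = cnj (cinner y x)"
    and cinner_add_left: "cinner (x + y) z = cinner x z + cinner y z"
    and cinner_scaleC_left: "cinner (c *\<^sub>C x) y = c * cinner x y"
    and inner_eq_Re_cinner: "inner x y = Re (cinner x y)"

class complex_hilbert = complex_inner + complete_space

instantiation complex :: complex_hilbert
begin

definition "scaleC c x = c * (x::complex)"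

definition "cinner x y = x * cnj y"

instance
  by standard
    (simp_all add: scaleC_complex_def cinner_complex_def algebra_simps scaleR_conv_of_real
      inner_complex_def)

end

text \<open>The Hilbert space direct sum of \<open>CARD('d)\<close> copies of \<open>'a\<close> is \<open>'a ^ 'd\<close>.\<close>

instantiation vec :: (complex_vector, finite) complex_vector
begin

definition "scaleC c x = (\<chi> i. c *\<^sub>C (x $ i))"

instance
  by standard
    (simp_all add: scaleC_vec_def vec_eq_iff scaleC_add_right scaleC_add_left scaleC_scaleC
      scaleC_one scaleR_scaleC)

end

instantiation vec :: (complex_inner, finite) complex_inner
begin

definition "cinner x y = (\<Sum>k\<in>UNIV. cinner (x $ k) (y $ k))"

instance
proof
  fix x y z :: "'a ^ 'b" and c :: complex
  show "cinner x y = cnj (cinner y x)"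
    unfolding cinner_vec_def cnj_sum by (rule sum.cong [OF refl cinner_commute])
  show "cinner (x + y) z = cinner x z + cinner y z"
    by (simp add: cinner_vec_def cinner_add_left sum.distrib)
  show "cinner (c *\<^sub>C x) y = c * cinner x y"
    by (simp add: cinner_vec_def scaleC_vec_def cinner_scaleC_left sum_distrib_left)
  show "inner x y = Re (cinner x y)"
    by (simp add: inner_vec_def cinner_vec_def inner_eq_Re_cinner)
qed

end

instance vec :: (complex_hilbert, finite) complex_hilbert ..

definition bounded_clinear :: "('a::complex_inner \<Rightarrow> 'a) \<Rightarrow> bool" where
  "bounded_clinear T \<longleftrightarrow> bounded_linear T \<and> (\<forall>c x. T (c *\<^sub>C x) = c *\<^sub>C T x)"

definition positive_op :: "('a::complex_inner \<Rightarrow> 'a) \<Rightarrow> bool" where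
  "positive_op A \<longleftrightarrow> bounded_clinear A \<and> (\<forall>x. cinner (A x) x \<in> \<real>\<^sub>\<ge>\<^sub>0)"

definition A_inner :: "('a::complex_inner \<Rightarrow> 'a) \<Rightarrow> 'a \<Rightarrow> 'a \<Rightarrow> complex" where
  "A_inner A x y = cinner (A x) y"

text \<open>For positive \<open>A\<close>, \<open>A_inner A x x\<close> is a nonnegative real number.\<close>

definition A_norm :: "('a::complex_inner \<Rightarrow> 'a) \<Rightarrow> 'a \<Rightarrow> real" where
  "A_norm A x = sqrt (Re (A_inner A x x))"

text \<open>The set \<open>B_{A^{1/2}}(H)\<close>.\<close>

definition A_bounded_ops :: "('a::complex_inner \<Rightarrow> 'a) \<Rightarrow> ('a \<Rightarrow> 'a) set" where
  "A_bounded_ops A =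
    {T. bounded_clinear T \<and> (\<exists>l>0. \<forall>x. A_norm A (T x) \<le> l * A_norm A x)}"

text \<open>
  For \<open>A\<close> positive and nonzero and \<open>T \<in> A_bounded_ops A\<close>, the supremum below is over a nonempty
  set (some \<open>x\<close> has \<open>A_norm A x = 1\<close>) that is bounded above (by Cauchy--Schwarz), so the
  real-valued supremum is the genuine one.
\<close>

definition A_numerical_radius :: "('a::complex_inner \<Rightarrow> 'a) \<Rightarrow> ('a \<Rightarrow> 'a) \<Rightarrow> real" where
  "A_numerical_radius A T = Sup {cmod (A_inner A (T x) x) | x. A_norm A x = 1}"

text \<open>The operator on the direct sum given by a matrix of operators.\<close>

definition op_matrix :: "('a::complex_inner \<Rightarrow> 'a) ^ 'd ^ 'd \<Rightarrow> 'a ^ 'd \<Rightarrow> 'a ^ 'd" where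
  "op_matrix T x = (\<chi> j. \<Sum>k\<in>UNIV. (T $ j $ k) (x $ k))"

definition diag_op_matrix :: "('a::complex_inner \<Rightarrow> 'a) \<Rightarrow> ('a \<Rightarrow> 'a) ^ 'd ^ 'd" where
  "diag_op_matrix A = (\<chi> j k. if j = k then A else (\<lambda>x. 0))"

definition zero_row_col :: "'d \<Rightarrow> ('a::complex_inner \<Rightarrow> 'a) ^ 'd ^ 'd \<Rightarrow> ('a \<Rightarrow> 'a) ^ 'd ^ 'd" where
  "zero_row_col i T = (\<chi> j k. if j = i \<or> k = i then (\<lambda>x. 0) else T $ j $ k)"

end

theory Submission
  imports Defs
begin

text \<open>
  A unit vector of \<open>H\<close> placed in the \<open>i\<close>-th coordinate turns the quadratic form of the operator
  matrix into that of \<open>T_ii\<close>, and setting the \<open>i\<close>-th coordinate of \<open>x\<close> to zero turns it into that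
  of \<open>S_i\<close> while not increasing the seminorm. Both bounds then follow from
  \<open>|\<langle>Tx, x\<rangle>| \<le> \<omega>(T) \<parallel>x\<parallel>\<^sup>2\<close>, valid for all \<open>x\<close> (null vectors of the seminorm included) because
  Cauchy--Schwarz bounds the quadratic form by a multiple of \<open>\<parallel>x\<parallel>\<^sup>2\<close>.
\<close>

section \<open>Sesquilinearity of the inner product and of the form given by
  \<open>A\<close>\<close>

lemma cinner_add_right: "cinner x (y + z) = cinner x y + cinner x z"
  by (metis cinner_add_left cinner_commute complex_cnj_add)

lemma cinner_scaleC_right: "cinner x (c *\<^sub>C y) = cnj c * cinner x y"
  by (metis cinner_commute cinner_scaleC_left complex_cnj_mult)

lemma cinner_zero_left [simp]: "cinner 0 x = 0"
  by (metis add_cancel_right_right cinner_add_left)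

lemma cinner_zero_right [simp]: "cinner x 0 = 0"
  by (metis cinner_commute cinner_zero_left complex_cnj_zero)

context
  fixes A :: "'a::complex_inner \<Rightarrow> 'a"
  assumes A: "bounded_clinear A"
begin

lemma A_inner_add_left: "A_inner A (x + y) z = A_inner A x z + A_inner A y z"
  using A by (simp add: A_inner_def bounded_clinear_def bounded_linear.linear linear_add
      cinner_add_left)

lemma A_inner_add_right: "A_inner A x (y + z) = A_inner A x y + A_inner A x z"
  by (simp add: A_inner_def cinner_add_right)

lemma A_inner_scaleC_left: "A_inner A (c *\<^sub>C x) y = c * A_inner A x y"
  using A by (simp add: A_inner_def bounded_clinear_def cinner_scaleC_left)

lemma A_inner_scaleC_right: "A_inner A x (c *\<^sub>C y) = cnj c * A_inner A x y"
  by (simp add: A_inner_def cinner_scaleC_right)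

lemma A_inner_zero_left [simp]: "A_inner A 0 x = 0"
  using A_inner_add_left[of 0 0 x] by simp

lemma A_inner_zero_right [simp]: "A_inner A x 0 = 0"
  by (simp add: A_inner_def)

lemma A_inner_sum_left: "A_inner A (\<Sum>k\<in>I. f k) y = (\<Sum>k\<in>I. A_inner A (f k) y)"
  by (induction I rule: infinite_finite_induct) (simp_all add: A_inner_add_left)

lemma A_norm_zero [simp]: "A_norm A 0 = 0"
  by (simp add: A_norm_def)

lemma A_inner_scaleR_self: "A_inner A (r *\<^sub>R x) (r *\<^sub>R y) = of_real (r\<^sup>2) * A_inner A x y"
  by (simp add: scaleR_scaleC A_inner_scaleC_left A_inner_scaleC_right power2_eq_square)

lemma A_norm_scaleR: "A_norm A (r *\<^sub>R x) = \<bar>r\<bar> * A_norm A x"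
  unfolding A_norm_def A_inner_scaleR_self by (simp add: real_sqrt_mult)

end

section \<open>Positive operators: Hermitian symmetry and Cauchy--Schwarz\<close>

lemma positive_opD:
  assumes "positive_op A"
  shows "bounded_clinear A" and "A_inner A x x = of_real ((A_norm A x)\<^sup>2)" and "0 \<le> A_norm A x"
proof -
  have "A_inner A x x \<in> \<real>\<^sub>\<ge>\<^sub>0"
    using assms by (simp add: positive_op_def A_inner_def)
  then show "A_inner A x x = of_real ((A_norm A x)\<^sup>2)" "0 \<le> A_norm A x"
    by (auto simp: A_norm_def complex_nonneg_Reals_iff complex_eq_iff)
qed (use assms in \<open>simp add: positive_op_def\<close>)

text \<open>Polarization: the form is real at \<open>x\<close>, at \<open>y\<close> and at
  \<open>x + c y\<close>, so the cross terms have a real sum for every complex \<open>c\<close>.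
  Taking \<open>c = 1\<close> compares imaginary parts, \<open>c = i\<close> real parts.\<close>

lemma A_inner_commute:
  assumes "positive_op A"
  shows "A_inner A x y = cnj (A_inner A y x)"
proof -
  note A = positive_opD(1)[OF assms]
  have real: "Im (c * A_inner A y x + cnj c * A_inner A x y) = 0" for c
  proof -
    have "A_inner A (x + c *\<^sub>C y) (x + c *\<^sub>C y) =
        A_inner A x x + (c * A_inner A y x + cnj c * A_inner A x y)
        + of_real ((cmod c)\<^sup>2) * A_inner A y y"
      by (simp add: A_inner_add_left[OF A] A_inner_add_right[OF A] A_inner_scaleC_left[OF A]
          A_inner_scaleC_right[OF A] complex_norm_square algebra_simps del: of_real_power)
    then show ?thesis
      by (auto simp: positive_opD(2)[OF assms] complex_eq_iff)
  qed
  show ?thesis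
    using real[of 1] real[of \<i>] by (simp add: complex_eq_iff)
qed

text \<open>The degenerate case \<open>q = 0\<close> has to be covered because the seminorm may
  vanish on nonzero vectors; a nonnegative affine function of \<open>t\<close> is constant.\<close>

lemma quadratic_nonneg_discriminant:
  fixes p q r :: real
  assumes "\<And>t. 0 \<le> p + 2 * t * r + t\<^sup>2 * q" and "0 \<le> q"
  shows "r\<^sup>2 \<le> p * q"
proof (cases "q = 0")
  case True
  have "r = 0"
  proof (rule ccontr)
    assume "r \<noteq> 0"
    then show False
      \<comment> \<open>At this \<open>t\<close> the affine function takes the value -1.\<close>
      using assms(1)[of "- (p + 1) / (2 * r)"] True by (simp add: field_simps)
  qed
  then show ?thesis using True by simp
next
  case False
  then show ?thesis
    \<comment> \<open>The minimizer of the parabola.\<close>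
    using assms(1)[of "- r / q"] assms(2) by (simp add: field_simps power2_eq_square)
qed

lemma A_inner_Cauchy_Schwarz:
  assumes "positive_op A"
  shows "cmod (A_inner A x y) \<le> A_norm A x * A_norm A y"
proof -
  note A = positive_opD(1)[OF assms]
  define z where "z = A_inner A x y"
  \<comment> \<open>The phase that rotates \<open>y\<close> so that the cross term becomes real. If
    \<open>z = 0\<close> then \<open>u = 0\<close>, so only \<open>cmod u\<close> at most 1 is
    available, which is enough below.\<close>
  define u where "u = sgn z"
  have u: "cnj u * z = of_real (cmod z)"
    using complex_norm_square[of z]
    by (cases "z = 0") (simp_all add: u_def sgn_eq field_simps power2_eq_square)
  have u': "u * cnj z = of_real (cmod z)"
    using u by (metis complex_cnj_cnj complex_cnj_complex_of_real complex_cnj_mult)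
  have nu: "(cmod u)\<^sup>2 \<le> 1"
    by (simp add: u_def norm_sgn)
  have "0 \<le> (A_norm A x)\<^sup>2 + 2 * t * cmod z + t\<^sup>2 * (A_norm A y)\<^sup>2" for t
  proof -
    define c where "c = of_real t * u"
    have "c * A_inner A y x + cnj c * A_inner A x y = of_real (2 * t * cmod z)"
      using u u'
      by (simp add: c_def A_inner_commute[OF assms, of y x] z_def[symmetric] mult.assoc)
    then have "A_inner A (x + c *\<^sub>C y) (x + c *\<^sub>C y) =
        A_inner A x x + of_real (2 * t * cmod z) + of_real ((cmod c)\<^sup>2) * A_inner A y y"
      by (simp add: A_inner_add_left[OF A] A_inner_add_right[OF A] A_inner_scaleC_left[OF A]
          A_inner_scaleC_right[OF A] complex_norm_square algebra_simps del: of_real_power)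
    then have "(A_norm A (x + c *\<^sub>C y))\<^sup>2 =
        (A_norm A x)\<^sup>2 + 2 * t * cmod z + (cmod c)\<^sup>2 * (A_norm A y)\<^sup>2"
      by (simp only: positive_opD(2)[OF assms] of_real_eq_iff flip: of_real_add of_real_mult)
    moreover have "(cmod c)\<^sup>2 * (A_norm A y)\<^sup>2 \<le> t\<^sup>2 * (A_norm A y)\<^sup>2"
      using nu by (intro mult_right_mono) (simp_all add: c_def norm_mult power_mult_distrib mult_left_le)
    ultimately show ?thesis
      by (smt (verit) zero_le_power2)
  qed
  then have "(cmod z)\<^sup>2 \<le> (A_norm A x)\<^sup>2 * (A_norm A y)\<^sup>2"
    by (rule quadratic_nonneg_discriminant) simp
  then show ?thesis
    unfolding z_def power_mult_distrib[symmetric]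
    by (rule power2_le_imp_le) (simp add: positive_opD(3)[OF assms])
qed

section \<open>Unit vectors of the seminorm and the numerical radius\<close>

lemma ex_A_norm_eq_1:
  assumes "positive_op A" and "A \<noteq> (\<lambda>x. 0)"
  shows "\<exists>x. A_norm A x = 1"
proof -
  obtain x where "A x \<noteq> 0" using assms(2) by auto
  then have "inner (A x) (A x) \<noteq> 0" by simp
  \<comment> \<open>Pairing \<open>x\<close> with \<open>A x\<close> gives the squared norm of
    \<open>A x\<close>, so by Cauchy--Schwarz \<open>x\<close> cannot be a null vector and may be
    normalized.\<close>
  then have "A_inner A x (A x) \<noteq> 0" by (auto simp: A_inner_def inner_eq_Re_cinner)
  then have "A_norm A x \<noteq> 0"
    using A_inner_Cauchy_Schwarz[OF assms(1), of x "A x"] by auto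
  then have "A_norm A ((1 / A_norm A x) *\<^sub>R x) = 1"
    by (simp add: A_norm_scaleR[OF positive_opD(1)[OF assms(1)]] positive_opD(3)[OF assms(1)])
  then show ?thesis ..
qed

text \<open>The bound \<open>L\<close> acts twice: it makes the set under the supremum bounded
  above, and it kills the form at null vectors, which cannot be normalized. Elsewhere the claim
  follows by scaling to a unit vector.\<close>

lemma A_numerical_radius_bound:
  assumes A: "positive_op A" and T: "linear T"
    and L: "\<And>x. cmod (A_inner A (T x) x) \<le> L * (A_norm A x)\<^sup>2"
  shows "cmod (A_inner A (T x) x) \<le> A_numerical_radius A T * (A_norm A x)\<^sup>2"
proof (cases "A_norm A x = 0")
  case True
  then show ?thesis using L[of x] by simp
next
  case False
  define r where "r = A_norm A x"
  have r: "0 < r" using False positive_opD(3)[OF A, of x] by (simp add: r_def)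
  define y where "y = (1 / r) *\<^sub>R x"
  have y: "A_norm A y = 1"
    using r by (simp add: y_def A_norm_scaleR[OF positive_opD(1)[OF A]] r_def[symmetric])
  have "bdd_above {cmod (A_inner A (T x) x) | x. A_norm A x = 1}"
  proof (rule bdd_aboveI)
    fix c assume "c \<in> {cmod (A_inner A (T x) x) | x. A_norm A x = 1}"
    then obtain v where "c = cmod (A_inner A (T v) v)" "A_norm A v = 1" by blast
    then show "c \<le> L" using L[of v] by simp
  qed
  then have le: "cmod (A_inner A (T y) y) \<le> A_numerical_radius A T"
    unfolding A_numerical_radius_def using y by (intro cSup_upper) auto
  have "x = r *\<^sub>R y" using r by (simp add: y_def)
  then have "cmod (A_inner A (T x) x) = r\<^sup>2 * cmod (A_inner A (T y) y)"
    by (simp add: linear_scale[OF T] A_inner_scaleR_self[OF positive_opD(1)[OF A]] norm_mult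
        norm_power del: of_real_power)
  then show ?thesis
    using le by (simp add: r_def[symmetric] mult.commute[of _ "r\<^sup>2"] mult_left_mono)
qed

text \<open>The unit vector excludes the supremum of the empty set, about which nothing useful is
  known.\<close>

lemma A_numerical_radius_le:
  assumes "\<exists>x. A_norm A x = 1"
    and "\<And>x. A_norm A x = 1 \<Longrightarrow> cmod (A_inner A (T x) x) \<le> w"
  shows "A_numerical_radius A T \<le> w"
  unfolding A_numerical_radius_def using assms by (intro cSup_least) auto

section \<open>Operator matrices on the direct sum\<close>

lemma bounded_clinear_zero: "bounded_clinear (\<lambda>x. 0 :: 'a::complex_inner)"
proof -
  have "c *\<^sub>C (0::'a) = 0" for c
    using scaleC_add_right[of c "0::'a" 0] by simp
  then show ?thesis by (simp add: bounded_clinear_def)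
qed

lemma scaleC_sum: "c *\<^sub>C (\<Sum>k\<in>I. f k) = (\<Sum>k\<in>I. c *\<^sub>C (f k :: 'a::complex_vector))"
proof -
  interpret Modules.additive "\<lambda>x::'a. c *\<^sub>C x"
    by standard (rule scaleC_add_right)
  show ?thesis by (rule sum)
qed

lemma bounded_clinear_op_matrix:
  fixes T :: "('a::complex_inner \<Rightarrow> 'a) ^ 'd ^ 'd"
  assumes "\<And>j k. bounded_clinear (T $ j $ k)"
  shows "bounded_clinear (op_matrix T)"
proof -
  have comp: "bounded_linear (\<lambda>x::'a^'d. \<Sum>k\<in>UNIV. (T $ j $ k) (x $ k))" for j
    using assms unfolding bounded_clinear_def
    by (intro bounded_linear_sum bounded_linear_compose[OF _ bounded_linear_vec_nth]) simp
  have "bounded_linear (op_matrix T)"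
  proof -
    obtain K where K: "\<And>j x. norm (\<Sum>k\<in>UNIV. (T $ j $ k) (x $ k)) \<le> norm x * K j"
      using bounded_linear.bounded[OF comp] by metis
    show ?thesis
    proof (rule bounded_linear_intro[of _ "sum K UNIV"])
      fix x y :: "'a ^ 'd" and r :: real
      show "op_matrix T (x + y) = op_matrix T x + op_matrix T y"
        using linear_add[OF bounded_linear.linear[OF comp]] by (simp add: op_matrix_def vec_eq_iff)
      show "op_matrix T (r *\<^sub>R x) = r *\<^sub>R op_matrix T x"
        using linear_scale[OF bounded_linear.linear[OF comp]] by (simp add: op_matrix_def vec_eq_iff)
      \<comment> \<open>The Euclidean norm is at most the sum of the coordinate norms, so the row
        bounds \<open>K j\<close> add up.\<close>
      have "norm (op_matrix T x) \<le> (\<Sum>j\<in>UNIV. norm (op_matrix T x $ j))"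
        unfolding norm_vec_def by (rule L2_set_le_sum) simp
      also have "\<dots> \<le> (\<Sum>j\<in>UNIV. norm x * K j)"
        using K by (intro sum_mono) (simp add: op_matrix_def)
      finally show "norm (op_matrix T x) \<le> norm x * sum K UNIV"
        by (simp add: sum_distrib_left)
    qed
  qed
  moreover have "op_matrix T (c *\<^sub>C x) = c *\<^sub>C op_matrix T x" for c x
    using assms by (simp add: op_matrix_def scaleC_vec_def vec_eq_iff scaleC_sum bounded_clinear_def)
  ultimately show ?thesis by (simp add: bounded_clinear_def)
qed

lemma diag_op_matrix_nth:
  "op_matrix (diag_op_matrix A) x $ j = (A (x $ j) :: 'a::complex_inner)"
proof -
  \<comment> \<open>With the argument moved inside the conditional, the sum collapses to its single
    term \<open>k = j\<close>.\<close>
  have "(\<Sum>k\<in>UNIV. (if j = k then A else (\<lambda>x. 0)) (x $ k)) =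
      (\<Sum>k\<in>UNIV. if j = k then A (x $ k) else 0)"
    by (intro sum.cong) auto
  then show ?thesis by (simp add: op_matrix_def diag_op_matrix_def)
qed

lemma A_inner_diag:
  "A_inner (op_matrix (diag_op_matrix A)) x y = (\<Sum>k\<in>UNIV. A_inner A (x $ k) (y $ k))"
  by (simp add: A_inner_def cinner_vec_def diag_op_matrix_nth)

lemma positive_op_diag:
  assumes "positive_op (A :: 'a::complex_inner \<Rightarrow> 'a)"
  shows "positive_op (op_matrix (diag_op_matrix A :: ('a \<Rightarrow> 'a) ^ 'd ^ 'd))"
  unfolding positive_op_def
proof (intro conjI allI)
  show "bounded_clinear (op_matrix (diag_op_matrix A :: ('a \<Rightarrow> 'a) ^ 'd ^ 'd))"
    using positive_opD(1)[OF assms]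
    by (intro bounded_clinear_op_matrix) (simp add: diag_op_matrix_def bounded_clinear_zero)
  fix x :: "'a ^ 'd"
  show "cinner (op_matrix (diag_op_matrix A) x) x \<in> \<real>\<^sub>\<ge>\<^sub>0"
    unfolding A_inner_def[symmetric] A_inner_diag
    by (simp add: positive_opD(2)[OF assms] complex_nonneg_Reals_iff sum_nonneg)
qed

lemma A_norm_diag:
  assumes "positive_op A"
  shows "(A_norm (op_matrix (diag_op_matrix A)) x)\<^sup>2 = (\<Sum>k\<in>UNIV. (A_norm A (x $ k))\<^sup>2)"
proof -
  have "of_real ((A_norm (op_matrix (diag_op_matrix A)) x)\<^sup>2) =
      (of_real (\<Sum>k\<in>UNIV. (A_norm A (x $ k))\<^sup>2) :: complex)"
    unfolding positive_opD(2)[OF positive_op_diag[OF assms], symmetric] A_inner_diag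
    by (simp add: positive_opD(2)[OF assms])
  then show ?thesis by (simp only: of_real_eq_iff)
qed

lemma A_norm_axis:
  assumes "positive_op A"
  shows "A_norm (op_matrix (diag_op_matrix A)) (axis i x) = A_norm A x"
proof -
  have "(A_norm A (axis i x $ k))\<^sup>2 = (if k = i then (A_norm A x)\<^sup>2 else 0)" for k
    by (simp add: axis_def A_norm_zero[OF positive_opD(1)[OF assms]])
  then have "(A_norm (op_matrix (diag_op_matrix A)) (axis i x))\<^sup>2 = (A_norm A x)\<^sup>2"
    by (simp add: A_norm_diag[OF assms])
  then show ?thesis
    by (rule power2_eq_imp_eq) (simp_all add: positive_opD(3) positive_op_diag assms)
qed

lemma A_inner_op_matrix:
  assumes "bounded_clinear A"
  shows "A_inner (op_matrix (diag_op_matrix A)) (op_matrix T x) x =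
    (\<Sum>j\<in>UNIV. \<Sum>k\<in>UNIV. A_inner A ((T $ j $ k) (x $ k)) (x $ j))"
  unfolding A_inner_diag by (simp add: op_matrix_def A_inner_sum_left[OF assms])

text \<open>Supplies the \<open>L\<close> of \<open>A_numerical_radius_bound\<close>:
  Cauchy--Schwarz bounds each entry's term by its constant \<open>l j k\<close>, since no coordinate
  exceeds the whole vector in seminorm, and the constants are summed.\<close>

lemma op_matrix_form_bounded:
  assumes A: "positive_op A" and T: "\<And>i j. T $ i $ j \<in> A_bounded_ops A"
  shows "\<exists>L. \<forall>x. cmod (A_inner (op_matrix (diag_op_matrix A)) (op_matrix T x) x)
    \<le> L * (A_norm (op_matrix (diag_op_matrix A)) x)\<^sup>2"
proof -
  let ?N = "A_norm (op_matrix (diag_op_matrix A))"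
  have "\<forall>j k. \<exists>l>0. \<forall>x. A_norm A ((T $ j $ k) x) \<le> l * A_norm A x"
    using T by (simp add: A_bounded_ops_def)
  then obtain l where l: "\<And>j k. 0 < l j k" "\<And>j k x. A_norm A ((T $ j $ k) x) \<le> l j k * A_norm A x"
    by metis
  have nth: "A_norm A (x $ k) \<le> ?N x" for x k
  proof (rule power2_le_imp_le)
    show "(A_norm A (x $ k))\<^sup>2 \<le> (?N x)\<^sup>2"
      unfolding A_norm_diag[OF A] by (rule member_le_sum) simp_all
  qed (rule positive_opD(3)[OF positive_op_diag[OF A]])
  have "cmod (A_inner (op_matrix (diag_op_matrix A)) (op_matrix T x) x)
      \<le> (\<Sum>j\<in>UNIV. \<Sum>k\<in>UNIV. l j k) * (?N x)\<^sup>2" for x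
  proof -
    have "cmod (A_inner A ((T $ j $ k) (x $ k)) (x $ j)) \<le> l j k * (?N x)\<^sup>2" for j k
    proof -
      have "cmod (A_inner A ((T $ j $ k) (x $ k)) (x $ j))
          \<le> A_norm A ((T $ j $ k) (x $ k)) * A_norm A (x $ j)"
        by (rule A_inner_Cauchy_Schwarz[OF A])
      also have "\<dots> \<le> (l j k * ?N x) * ?N x"
        using l[of j k] nth positive_opD(3)[OF A] positive_opD(3)[OF positive_op_diag[OF A], of x]
        by (intro mult_mono order_trans[OF l(2)] mult_left_mono mult_nonneg_nonneg)
          (simp_all add: less_imp_le)
      finally show ?thesis by (simp add: power2_eq_square)
    qed
    then show ?thesis
      unfolding A_inner_op_matrix[OF positive_opD(1)[OF A]] sum_distrib_right
      by (intro order_trans[OF norm_sum] sum_mono)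
  qed
  then show ?thesis by blast
qed

theorem theorem3p6:
  fixes A :: "'a::complex_hilbert \<Rightarrow> 'a"
    and T :: "('a \<Rightarrow> 'a) ^ 'd ^ 'd"
  assumes "positive_op A"
    and "A \<noteq> (\<lambda>x. 0)"
    and "\<And>i j. T $ i $ j \<in> A_bounded_ops A"
  shows "A_numerical_radius (op_matrix (diag_op_matrix A)) (op_matrix T) \<ge>
    Max (range (\<lambda>i. A_numerical_radius A (T $ i $ i)) \<union>
         range (\<lambda>i. A_numerical_radius (op_matrix (diag_op_matrix A)) (op_matrix (zero_row_col i T))))"
proof -
  let ?A = "op_matrix (diag_op_matrix A :: ('a \<Rightarrow> 'a) ^ 'd ^ 'd)"
  let ?w = "A_numerical_radius ?A (op_matrix T)"
  note A = positive_opD(1)[OF assms(1)]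
  have T: "bounded_clinear (T $ j $ k)" for j k
    using assms(3)[of j k] by (simp add: A_bounded_ops_def)
  have T0: "(T $ j $ k) 0 = 0" for j k
    using T[of j k] by (simp add: bounded_clinear_def bounded_linear.linear linear_0)
  have "linear (op_matrix T)"
    using bounded_clinear_op_matrix[of T, OF T]
    by (simp add: bounded_clinear_def bounded_linear.linear)
  moreover obtain L where "\<And>x. cmod (A_inner ?A (op_matrix T x) x) \<le> L * (A_norm ?A x)\<^sup>2"
    using op_matrix_form_bounded[of A T, OF assms(1,3)] by blast
  ultimately have w: "cmod (A_inner ?A (op_matrix T x) x) \<le> ?w * (A_norm ?A x)\<^sup>2" for x
    by (rule A_numerical_radius_bound[OF positive_op_diag[OF assms(1)]])
  obtain u where u: "A_norm A u = 1"
    using ex_A_norm_eq_1[OF assms(1,2)] by blast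
  have uax: "A_norm ?A (axis i u) = 1" for i
    by (simp add: A_norm_axis[OF assms(1)] u)
  have w0: "0 \<le> ?w"
    \<comment> \<open>Any index would do; \<open>undefined\<close> names one.\<close>
    using order_trans[OF norm_ge_zero w[of "axis undefined u"]] by (simp add: uax)
  have diag: "A_numerical_radius A (T $ i $ i) \<le> ?w" for i
  proof (rule A_numerical_radius_le)
    fix x assume x: "A_norm A x = 1"
    \<comment> \<open>Off the index \<open>i\<close> the vector is zero and the entries of
      \<open>T\<close> map 0 to 0, so only the \<open>(i, i)\<close> term survives.\<close>
    have "A_inner A ((T $ j $ k) (axis i x $ k)) (axis i x $ j) =
        (if j = i then if k = i then A_inner A ((T $ i $ i) x) x else 0 else 0)" for j k
      by (simp add: axis_def T0 A_inner_zero_left[OF A] A_inner_zero_right[OF A])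
    then have "A_inner ?A (op_matrix T (axis i x)) (axis i x) =
        (\<Sum>j\<in>UNIV. if j = i then A_inner A ((T $ i $ i) x) x else 0)"
      unfolding A_inner_op_matrix[OF A] by (intro sum.cong) simp_all
    then show "cmod (A_inner A ((T $ i $ i) x) x) \<le> ?w"
      using w[of "axis i x"] by (simp add: A_norm_axis[OF assms(1)] x)
  qed (use u in blast)
  have zero: "A_numerical_radius ?A (op_matrix (zero_row_col i T)) \<le> ?w" for i
  proof (rule A_numerical_radius_le)
    fix x assume x: "A_norm ?A x = 1"
    \<comment> \<open>A zero coordinate has the effect of both deletions: as the argument of
      \<open>T\<close> it removes column \<open>i\<close>, in the second slot of the form it removes
      row \<open>i\<close>.\<close>
    define y where "y = (\<chi> k. if k = i then 0 else x $ k)"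
    have "A_inner A ((zero_row_col i T $ j $ k) (x $ k)) (x $ j) =
        A_inner A ((T $ j $ k) (y $ k)) (y $ j)" for j k
      by (simp add: zero_row_col_def y_def T0 A_inner_zero_left[OF A] A_inner_zero_right[OF A])
    then have "A_inner ?A (op_matrix (zero_row_col i T) x) x = A_inner ?A (op_matrix T y) y"
      unfolding A_inner_op_matrix[OF A] by simp
    moreover have "(A_norm ?A y)\<^sup>2 \<le> (A_norm ?A x)\<^sup>2"
      unfolding A_norm_diag[OF assms(1)]
      by (intro sum_mono) (simp add: y_def A_norm_zero[OF A])
    \<comment> \<open>\<open>y\<close> need not be a unit vector, only of seminorm at most 1, hence
      the appeal to \<open>w0\<close>.\<close>
    then have "?w * (A_norm ?A y)\<^sup>2 \<le> ?w"
      using w0 by (simp add: x mult_left_le)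
    ultimately show "cmod (A_inner ?A (op_matrix (zero_row_col i T) x) x) \<le> ?w"
      using w[of y] by simp
  qed (use uax in blast)
  show ?thesis
    using diag zero by (intro Max.boundedI) auto
qed

end
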